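(* Let $d\ge 2$ and let $f(z)=\sum_{i=0}^d a_i z^i\in\mathbb{C}[z]$ be a polynomial of degree $d$ (so $a_d\neq 0$) with $a_0\neq 0$, $a_1\neq 0$, $a_2\neq 0$, and let $z_1,\ldots,z_d$ be its zeros (with multiplicity). Put $t=a_0/a_1$ and define \[ F_0(x_0,x_1)=\sum_{i=0}^{d-1}\sum_{j=0}^{\lfloor i/2\rfloor}-\frac{a_{i+1}}{a_2}\,(t x_1)^j\,x_0^{\,i-2j}\binom{i-j}{j}, \] \[ F_1(x_0,x_1)=-\frac{a_1}{a_2}+\sum_{i=0}^{d-2}\sum_{j=0}^{\lfloor i/2\rfloor}-\frac{a_{i+2}}{a_2}\,(t x_1)^j\,x_0^{\,i-2j}\,x_1\binom{i-j}{j}. \] If $(\alpha_0,\alpha_1)\in\mathbb{C}^2$ is an attractor point of NRS(2) applied to $f$ (with arbitrary starting point), i.e. $F_0(\alpha_0,\alpha_1)=F_1(\alpha_0,\alpha_1)=0$, then \[ \alpha_0\in\{z_i+z_j : 1\le i<j\le d\}. \]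
   Context: NRS(2) is the two-dimensional Newton–Raphson–Simpson iteration applied to the system of two polynomial equations $f_{0,2}(x_0,x_1)-x_0=0$, $f_{1,2}(x_0,x_1)-x_1=0$, where $f_{0,2}(x_0,x_1)-x_0=F_0(x_0,x_1)$ and $f_{1,2}(x_0,x_1)-x_1=F_1(x_0,x_1)$ are the polynomials displayed in the claim; its attractor points (fixed points) are the common zeros of $F_0$ and $F_1$. *)

theory Defs
  imports Complex_Main "HOL-Computational_Algebra.Polynomial"
begin

definition nrs2_F0 :: "complex poly \<Rightarrow> complex \<Rightarrow> complex \<Rightarrow> complex" where
  "nrs2_F0 f x0 x1 =
     (let a = coeff f; d = degree f; t = a 0 / a 1 in
      \<Sum>i=0..d-1. \<Sum>j=0..i div 2.
        - (a (i+1) / a 2) * (t * x1) ^ j * x0 ^ (i - 2*j) * of_nat ((i - j) choose j))"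

definition nrs2_F1 :: "complex poly \<Rightarrow> complex \<Rightarrow> complex \<Rightarrow> complex" where
  "nrs2_F1 f x0 x1 =
     (let a = coeff f; d = degree f; t = a 0 / a 1 in
      - (a 1 / a 2) + (\<Sum>i=0..d-2. \<Sum>j=0..i div 2.
        - (a (i+2) / a 2) * (t * x1) ^ j * x0 ^ (i - 2*j) * x1 * of_nat ((i - j) choose j)))"

text \<open>
  The two-dimensional Newton iteration solves the system
  \<open>f02 x0 x1 - x0 = 0\<close>, \<open>f12 x0 x1 - x1 = 0\<close>, whose left-hand sides are
  \<open>nrs2_F0 f x0 x1\<close> and \<open>nrs2_F1 f x0 x1\<close>. Its attractor points are by definition the
  common zeros of these two polynomials; the starting point plays no role.
\<close>
definition nrs2_attractor :: "complex poly \<Rightarrow> complex \<times> complex \<Rightarrow> bool" where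
  "nrs2_attractor f = (\<lambda>(x0, x1). nrs2_F0 f x0 x1 = 0 \<and> nrs2_F1 f x0 x1 = 0)"

end

theory Submission
  imports Defs
begin

text \<open>
  Write \<open>c = t x\<^sub>1\<close> and \<open>S\<^sub>i = \<Sum>\<^sub>j c^j x\<^sub>0^(i-2j) binom(i-j,j)\<close>. These sums satisfy
  \<open>S\<^bsub>i+2\<^esub> = x\<^sub>0 S\<^bsub>i+1\<^esub> + c S\<^sub>i\<close>, so that \<open>z^(i+2)\<close> has remainder \<open>S\<^bsub>i+1\<^esub> z + c S\<^sub>i\<close> modulo
  \<open>q = z^2 - x\<^sub>0 z - c\<close>. The remainder of \<open>f\<close> modulo \<open>q\<close> is therefore
  \<open>-a\<^sub>2 (F\<^sub>0 z + t F\<^sub>1)\<close>. At an attractor point \<open>q\<close> divides \<open>f\<close>, and \<open>x\<^sub>0\<close>,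
  being the sum of the two zeros of \<open>q\<close>, is the sum of two zeros of \<open>f\<close>.
\<close>

definition lucas_sum :: "'a::comm_ring_1 \<Rightarrow> 'a \<Rightarrow> nat \<Rightarrow> 'a" where
  "lucas_sum x c i = (\<Sum>j=0..i div 2. c ^ j * x ^ (i - 2*j) * of_nat ((i - j) choose j))"

text \<open>For j beyond \<open>i div 2\<close> the binomial vanishes, as \<open>i - j < j\<close>.
  A summation range free of \<open>i div 2\<close> lets sums for consecutive i be compared term by
  term, without a parity split.\<close>

lemma lucas_sum_extend:
  assumes "i \<le> N"
  shows "lucas_sum x c i = (\<Sum>j\<le>N. c ^ j * x ^ (i - 2*j) * of_nat ((i - j) choose j))"
  unfolding lucas_sum_def
proof (rule sum.mono_neutral_left)
  show "\<forall>j\<in>{..N} - {0..i div 2}. c ^ j * x ^ (i - 2*j) * of_nat ((i - j) choose j) = 0"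
  proof
    fix j assume "j \<in> {..N} - {0..i div 2}"
    then have "i - j < j" by auto
    then show "c ^ j * x ^ (i - 2*j) * of_nat ((i - j) choose j) = 0"
      by (simp add: binomial_eq_0)
  qed
qed (use assms in auto)

lemma lucas_sum_0 [simp]: "lucas_sum x c 0 = 1"
  and lucas_sum_1 [simp]: "lucas_sum x c (Suc 0) = x"
  by (simp_all add: lucas_sum_def)

text \<open>Pascal's rule splits every term with positive j in two. One half adds up to c times the
  sum for i; the other half, \<open>?A\<close>, together with the term j = 0 is x times the sum for
  i + 1.\<close>

lemma lucas_sum_rec:
  "lucas_sum x c (Suc (Suc i)) = x * lucas_sum x c (Suc i) + c * lucas_sum x c i"
proof -
  let ?A = "\<Sum>j\<le>i. c ^ Suc j * x ^ (i - 2*j) * of_nat ((i - j) choose Suc j)"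
  have pascal: "(Suc i - j) choose Suc j = ((i - j) choose j) + ((i - j) choose Suc j)"
    if "j \<le> i" for j
    using that by (simp add: Suc_diff_le)
  \<comment> \<open>The term j = i + 2 drops out because its binomial is 0 over i + 2.\<close>
  have "lucas_sum x c (Suc (Suc i)) =
      (\<Sum>j\<le>Suc i. c ^ j * x ^ (Suc (Suc i) - 2*j) * of_nat ((Suc (Suc i) - j) choose j))"
    unfolding lucas_sum_extend[OF order_refl, of x c "Suc (Suc i)"]
    by (simp add: sum.atMost_Suc[of _ "Suc i"] del: binomial_Suc_Suc)
  also have "\<dots> = x ^ Suc (Suc i) +
      (\<Sum>j\<le>i. c ^ Suc j * x ^ (i - 2*j) * of_nat ((Suc i - j) choose Suc j))"
    by (subst sum.atMost_Suc_shift) (simp del: binomial_Suc_Suc)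
  also have "(\<Sum>j\<le>i. c ^ Suc j * x ^ (i - 2*j) * of_nat ((Suc i - j) choose Suc j))
      = c * lucas_sum x c i + ?A"
    unfolding lucas_sum_extend[OF order_refl, of x c i] sum_distrib_left sum.distrib[symmetric]
    by (rule sum.cong) (simp_all add: pascal algebra_simps del: binomial_Suc_Suc)
  finally have lhs: "lucas_sum x c (Suc (Suc i)) = x ^ Suc (Suc i) + c * lucas_sum x c i + ?A"
    by (simp add: algebra_simps)
  \<comment> \<open>When 2j >= i, truncated subtraction makes both exponents of x equal to 0 and the
    extra factor x is not absorbed; there the binomial is 0.\<close>
  have "x * (c ^ Suc j * x ^ (Suc i - 2 * Suc j) * of_nat ((i - j) choose Suc j))
      = c ^ Suc j * x ^ (i - 2*j) * of_nat ((i - j) choose Suc j)" for j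
  proof (cases "Suc (2 * j) \<le> i")
    case True
    then have "i - 2*j = Suc (Suc i - 2 * Suc j)" by simp
    then show ?thesis by (simp add: algebra_simps)
  next
    case False
    then have "i - j < Suc j" by simp
    then show ?thesis by (simp add: binomial_eq_0)
  qed
  then have "x * lucas_sum x c (Suc i) = x ^ Suc (Suc i) + ?A"
    unfolding lucas_sum_extend[OF order_refl, of x c "Suc i"]
    by (subst sum.atMost_Suc_shift) (simp add: distrib_left sum_distrib_left)
  with lhs show ?thesis by (simp add: algebra_simps)
qed

text \<open>The first two cases stand apart because the general formula would refer to Lucas sums at
  the indices -2 and -1.\<close>

fun quadratic_rem :: "'a::comm_ring_1 \<Rightarrow> 'a \<Rightarrow> nat \<Rightarrow> 'a poly" where
  "quadratic_rem x c 0 = [:1:]"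
| "quadratic_rem x c (Suc 0) = [:0, 1:]"
| "quadratic_rem x c (Suc (Suc n)) = [:c * lucas_sum x c n, lucas_sum x c (Suc n):]"

lemma quadratic_dvd_monom_minus_rem:
  "[:- c, - x, 1:] dvd monom 1 n - quadratic_rem x c n"
proof (induction n)
  case 0
  then show ?case by (simp add: monom_0)
next
  case (Suc n)
  obtain r where r: "monom 1 n = [:- c, - x, 1:] * r + quadratic_rem x c n"
    using Suc by (metis dvdE diff_eq_eq)
  \<comment> \<open>Multiplying the remainder by z gives degree at most 2, so one subtraction of a
    constant multiple of the quadratic reduces it. The constant k is the coefficient of z in the old
    remainder: 0, 1, or a Lucas sum.\<close>
  have "\<exists>k. [:0, 1:] * quadratic_rem x c n - quadratic_rem x c (Suc n) = [:- c, - x, 1:] * [:k:]"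
  proof (cases n)
    case 0
    then show ?thesis by (intro exI[of _ 0]) simp
  next
    case n: (Suc m)
    show ?thesis
    proof (cases m)
      case 0
      then show ?thesis using n by (intro exI[of _ 1]) simp
    next
      case (Suc l)
      then show ?thesis using n
        by (intro exI[of _ "lucas_sum x c (Suc l)"]) (simp add: lucas_sum_rec algebra_simps)
    qed
  qed
  then obtain k where
    k: "[:0, 1:] * quadratic_rem x c n - quadratic_rem x c (Suc n) = [:- c, - x, 1:] * [:k:]"
    by blast
  have "monom 1 (Suc n) = [:0, 1:] * monom (1::'a) n"
    by (simp add: monom_Suc)
  then have "monom 1 (Suc n) - quadratic_rem x c (Suc n) =
      [:- c, - x, 1:] * ([:0, 1:] * r) +
      ([:0, 1:] * quadratic_rem x c n - quadratic_rem x c (Suc n))"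
    unfolding r by (simp only: algebra_simps)
  also have "\<dots> = [:- c, - x, 1:] * ([:0, 1:] * r + [:k:])"
    unfolding k by (simp only: distrib_left)
  finally show ?case by (metis dvd_triv_left)
qed

lemma quadratic_dvd_minus_rem:
  fixes f :: "'a::comm_ring_1 poly"
  shows "[:- c, - x, 1:] dvd f - (\<Sum>i\<le>degree f. smult (coeff f i) (quadratic_rem x c i))"
proof -
  have "f = (\<Sum>i\<le>degree f. smult (coeff f i) (monom 1 i))"
    by (simp add: smult_monom poly_as_sum_of_monoms)
  then have "f - (\<Sum>i\<le>degree f. smult (coeff f i) (quadratic_rem x c i)) =
      (\<Sum>i\<le>degree f. smult (coeff f i) (monom 1 i - quadratic_rem x c i))"
    by (simp add: sum_subtractf smult_diff_right)
  then show ?thesis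
    by (simp add: dvd_sum dvd_smult quadratic_dvd_monom_minus_rem)
qed

text \<open>Sorts the remainder by powers of z: the sum occurring in \<open>nrs2_F1\<close> appears
  in the constant coefficient, that of \<open>nrs2_F0\<close> in the linear one.\<close>

lemma sum_quadratic_rem:
  "(\<Sum>i\<le>Suc (Suc n). smult (a i) (quadratic_rem x c i)) =
    [:a 0 + c * (\<Sum>i\<le>n. a (i + 2) * lucas_sum x c i),
      (\<Sum>i\<le>Suc n. a (i + 1) * lucas_sum x c i):]"
  by (induction n) (simp_all add: algebra_simps numeral_2_eq_2)

lemma nrs2_F0_eq:
  "nrs2_F0 f x y = - (\<Sum>i\<le>degree f - 1. coeff f (i + 1) *
      lucas_sum x (coeff f 0 / coeff f 1 * y) i) / coeff f 2"
  by (simp add: nrs2_F0_def Let_def lucas_sum_def sum_distrib_left sum_divide_distrib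
      sum_negf[symmetric] atLeast0AtMost mult.assoc)

lemma nrs2_F1_eq:
  "nrs2_F1 f x y = - (coeff f 1 + y * (\<Sum>i\<le>degree f - 2. coeff f (i + 2) *
      lucas_sum x (coeff f 0 / coeff f 1 * y) i)) / coeff f 2"
  by (simp add: nrs2_F1_def Let_def lucas_sum_def sum_distrib_left sum_divide_distrib
      sum_negf atLeast0AtMost add_divide_distrib diff_divide_distrib mult_ac)

lemma nrs2_attractor_imp_quadratic_dvd:
  assumes "degree f \<ge> 2" "coeff f 1 \<noteq> 0" "coeff f 2 \<noteq> 0" "nrs2_attractor f (x, y)"
  shows "[:- (coeff f 0 / coeff f 1 * y), - x, 1:] dvd f"
proof -
  define c where "c = coeff f 0 / coeff f 1 * y"
  obtain n where n: "degree f = Suc (Suc n)"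
    using assms(1) by (metis add_2_eq_Suc le_Suc_ex)
  have F0: "(\<Sum>i\<le>Suc n. coeff f (i + 1) * lucas_sum x c i) = 0"
    using assms n by (simp add: nrs2_attractor_def nrs2_F0_eq c_def del: sum.atMost_Suc)
  have F1: "coeff f 1 + y * (\<Sum>i\<le>n. coeff f (i + 2) * lucas_sum x c i) = 0"
    using assms n unfolding nrs2_attractor_def nrs2_F1_eq c_def
    by (simp add: add_eq_0_iff del: One_nat_def)
  \<comment> \<open>With t = a_0 / a_1, both a_0 = t a_1 and c = t y carry the factor t, so the
    constant coefficient is t times the expression that vanishes by \<open>F1\<close>.\<close>
  have "coeff f 0 + c * (\<Sum>i\<le>n. coeff f (i + 2) * lucas_sum x c i) =
      coeff f 0 / coeff f 1 * (coeff f 1 + y * (\<Sum>i\<le>n. coeff f (i + 2) * lucas_sum x c i))"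
    using assms(2) by (simp add: c_def distrib_left del: One_nat_def)
  then have "(\<Sum>i\<le>degree f. smult (coeff f i) (quadratic_rem x c i)) = 0"
    unfolding n sum_quadratic_rem F0 F1 by simp
  then show ?thesis
    using quadratic_dvd_minus_rem[of c x f] by (simp add: c_def)
qed

text \<open>The factor of index i is cancelled before v is located among the remaining ones. This
  forces different indices even when u = v, so multiplicities are respected.\<close>

lemma linear_factors_dvd_imp_distinct_indices:
  fixes z :: "'i \<Rightarrow> 'a::idom"
  assumes "finite I" "k \<noteq> 0"
    and dvd: "[:- u, 1:] * [:- v, 1:] dvd smult k (\<Prod>i\<in>I. [:- z i, 1:])"
  obtains i j where "i \<in> I" "j \<in> I" "i \<noteq> j" "u = z i" "v = z j"
proof -
  have "[:- u, 1:] dvd smult k (\<Prod>i\<in>I. [:- z i, 1:])"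
    using dvd by (rule dvd_mult_left)
  then have "poly (smult k (\<Prod>i\<in>I. [:- z i, 1:])) u = 0"
    by (simp only: poly_eq_0_iff_dvd)
  then obtain i where i: "i \<in> I" "u = z i"
    using assms by (auto simp: poly_prod)
  have "[:- u, 1:] * [:- v, 1:] dvd [:- u, 1:] * smult k (\<Prod>i\<in>I - {i}. [:- z i, 1:])"
    using dvd assms(1) i by (simp add: prod.remove)
  then have "[:- v, 1:] dvd smult k (\<Prod>i\<in>I - {i}. [:- z i, 1:])"
    by (subst (asm) dvd_mult_cancel_left) simp
  then have "poly (smult k (\<Prod>i\<in>I - {i}. [:- z i, 1:])) v = 0"
    by (simp only: poly_eq_0_iff_dvd)
  then obtain j where "j \<in> I - {i}" "v = z j"
    using assms by (auto simp: poly_prod)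
  with i that show ?thesis by blast
qed

theorem theorem3:
  fixes f :: "complex poly" and d :: nat and z :: "nat \<Rightarrow> complex" and \<alpha>0 \<alpha>1 :: complex
  assumes "d \<ge> 2"
    and "degree f = d"
    and "coeff f 0 \<noteq> 0" and "coeff f 1 \<noteq> 0" and "coeff f 2 \<noteq> 0"
    and zeros: "f = smult (coeff f d) (\<Prod>i=1..d. [:- z i, 1:])"
    and "nrs2_attractor f (\<alpha>0, \<alpha>1)"
  shows "\<alpha>0 \<in> {z i + z j | i j. 1 \<le> i \<and> i < j \<and> j \<le> d}"
proof -
  define c where "c = coeff f 0 / coeff f 1 * \<alpha>1"
  \<comment> \<open>A square root of the discriminant of z^2 - \<alpha>0 z - c; u and v are then the
    two zeros of this quadratic.\<close>
  define s where "s = csqrt (\<alpha>0\<^sup>2 + 4 * c)"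
  define u v where "u = (\<alpha>0 + s) / 2" and "v = (\<alpha>0 - s) / 2"
  have s2: "s * s = \<alpha>0 * \<alpha>0 + 4 * c"
    by (simp add: s_def power2_eq_square[symmetric])
  have sum: "u + v = \<alpha>0"
    by (simp add: u_def v_def field_simps)
  have "u * v = - c"
    using s2 by (simp add: u_def v_def field_simps)
  with sum have "[:- c, - \<alpha>0, 1:] = [:- u, 1:] * [:- v, 1:]"
    by (auto simp: algebra_simps)
  moreover have "[:- c, - \<alpha>0, 1:] dvd f"
    using nrs2_attractor_imp_quadratic_dvd assms unfolding c_def by blast
  ultimately have "[:- u, 1:] * [:- v, 1:] dvd smult (coeff f d) (\<Prod>i=1..d. [:- z i, 1:])"
    using zeros by metis
  moreover have "coeff f d \<noteq> 0"
    using assms by auto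
  ultimately obtain i j where "i \<in> {1..d}" "j \<in> {1..d}" "i \<noteq> j" "u = z i" "v = z j"
    using linear_factors_dvd_imp_distinct_indices[OF finite_atLeastAtMost] by metis
  \<comment> \<open>The indices come in no particular order; if j < i, their roles are exchanged, as
    the sum is symmetric.\<close>
  with sum show ?thesis
    by (cases i j rule: linorder_cases) (force simp: add.commute)+
qed

end
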